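(* Consider the continuous-time planar system $$\dot x = x(1-x)-xy,\qquad \dot y=\gamma xy-ry .$$ If $0<\gamma\le r$, then the equilibrium point $E_1=(1,0)$ of this system is globally asymptotically stable.
   Context: The system is a (rescaled) phytoplankton-zooplankton model with real parameters $r,\gamma$, where $x$ is the phytoplankton density, $y$ is the zooplankton density, and the dot denotes the derivative with respect to time $t\ge 0$.
   Formalization: Global asymptotic stability is stated relative to densities x > 0, y ≥ 0, since on the plane or the closed quadrant it fails: (0,0) is another equilibrium and the axis x = 0 is invariant. *)

theory Defs
  imports "HOL-Analysis.Analysis"
begin

definition pz_field :: "real \<Rightarrow> real \<Rightarrow> real \<times> real \<Rightarrow> real \<times> real" where
  "pz_field \<gamma> r = (\<lambda>(x, y). (x * (1 - x) - x * y, \<gamma> * x * y - r * y))"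

text \<open>
  Admissible population densities. The axis \<open>x = 0\<close> is invariant and contains the equilibrium
  \<open>(0, 0)\<close>, so no solution starting on it tends to \<open>(1, 0)\<close>: ``globally'' can only refer to
  states with \<open>x > 0\<close>. Negative \<open>y\<close> has no meaning for a density, and must be excluded: for
  \<open>\<gamma> = r\<close> the point \<open>(1, 0)\<close> is not stable with respect to perturbations with \<open>y < 0\<close>.
\<close>
definition pz_states :: "(real \<times> real) set" where
  "pz_states = {(x, y). x > 0 \<and> y \<ge> 0}"

definition forward_solution ::
    "('a::real_normed_vector \<Rightarrow> 'a) \<Rightarrow> (real \<Rightarrow> 'a) \<Rightarrow> bool" where
  "forward_solution f u \<longleftrightarrow> (\<forall>t\<ge>0. (u has_vector_derivative f (u t)) (at t within {0..}))"

definition equilibrium :: "('a::real_normed_vector \<Rightarrow> 'a) \<Rightarrow> 'a \<Rightarrow> bool" where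
  "equilibrium f e \<longleftrightarrow> f e = 0"

text \<open>
  Every state in \<open>X\<close> is the start of a solution that exists for all \<open>t \<ge> 0\<close> and stays in \<open>X\<close>.
  This excludes finite-time blow-up, and makes the quantification over solutions in the
  notions below non-vacuous.
\<close>
definition forward_complete_on :: "('a::real_normed_vector \<Rightarrow> 'a) \<Rightarrow> 'a set \<Rightarrow> bool" where
  "forward_complete_on f X \<longleftrightarrow>
     (\<forall>p\<in>X. \<exists>u. forward_solution f u \<and> u 0 = p \<and> (\<forall>t\<ge>0. u t \<in> X))"

definition lyapunov_stable_on ::
    "('a::real_normed_vector \<Rightarrow> 'a) \<Rightarrow> 'a set \<Rightarrow> 'a \<Rightarrow> bool" where
  "lyapunov_stable_on f X e \<longleftrightarrow>
     (\<forall>\<epsilon>>0. \<exists>\<delta>>0. \<forall>u. forward_solution f u \<longrightarrow> u 0 \<in> X \<longrightarrow> dist (u 0) e < \<delta> \<longrightarrow>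
        (\<forall>t\<ge>0. dist (u t) e < \<epsilon>))"

definition globally_attractive_on ::
    "('a::real_normed_vector \<Rightarrow> 'a) \<Rightarrow> 'a set \<Rightarrow> 'a \<Rightarrow> bool" where
  "globally_attractive_on f X e \<longleftrightarrow>
     (\<forall>u. forward_solution f u \<longrightarrow> u 0 \<in> X \<longrightarrow> (u \<longlongrightarrow> e) at_top)"

definition globally_asymptotically_stable_on ::
    "('a::real_normed_vector \<Rightarrow> 'a) \<Rightarrow> 'a set \<Rightarrow> 'a \<Rightarrow> bool" where
  "globally_asymptotically_stable_on f X e \<longleftrightarrow>
     e \<in> X \<and> equilibrium f e \<and> forward_complete_on f X \<and>
     lyapunov_stable_on f X e \<and> globally_attractive_on f X e"

end

theory Submission
  imports Defs
begin

text \<open>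
  Along a solution, \<open>V = \<gamma> * (x - 1 - ln x) + y\<close> satisfies
  \<open>V' = - \<gamma> * (x - 1)\<^sup>2 - (r - \<gamma>) * y \<le> 0\<close>, and \<open>V\<close> controls the distance to \<open>(1, 0)\<close>
  because \<open>x - 1 - ln x \<ge> (sqrt x - 1)\<^sup>2\<close>; this gives stability. For attractivity, the
  dissipation forces \<open>x \<rightarrow> 1\<close>, also when \<open>\<gamma> = r\<close>; then \<open>y\<close> tends to \<open>L = lim V\<close>, and
  \<open>x' \<rightarrow> - L\<close> leaves only \<open>L = 0\<close>. For existence, clamping the densities makes the field globally
  Lipschitz, and a priori bounds on \<open>x\<close> and \<open>\<gamma> * x + y\<close> show that the clamp is never active.
\<close>

subsection \<open>Calculus on the half line\<close>

lemma half_line_mvt: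
  fixes f f' :: "real \<Rightarrow> real"
  assumes "\<And>t. t \<ge> 0 \<Longrightarrow> (f has_real_derivative f' t) (at t within {0..})"
    and "0 \<le> a" "a \<le> b"
  shows "\<exists>s\<in>{a..b}. f b - f a = f' s * (b - a)"
proof (rule mvt_very_simple[OF \<open>a \<le> b\<close>])
  fix t assume "a \<le> t" "t \<le> b"
  then have "(f has_real_derivative f' t) (at t within {a..b})"
    using assms by (intro DERIV_subset[OF assms(1)]) auto
  then show "(f has_derivative (*) (f' t)) (at t within {a..b})"
    by (simp add: has_field_derivative_def)
qed

lemma half_line_integral_has_vector_derivative:
  fixes h :: "real \<Rightarrow> 'a::banach"
  assumes "continuous_on {0..} h" "t \<ge> 0"
  shows "((\<lambda>t. integral {0..t} h) has_vector_derivative h t) (at t within {0..})"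
proof -
  \<comment> \<open>A right endpoint beyond \<open>t\<close> makes the compact interval and the half
    line agree near \<open>t\<close>, also when \<open>t = 0\<close>.\<close>
  have "((\<lambda>t. integral {0..t} h) has_vector_derivative h t) (at t within {0..t+1})"
    using assms by (intro integral_has_vector_derivative continuous_on_subset[OF assms(1)]) auto
  moreover have "at t within {0..t+1} = at t within {0..}"
    by (rule at_within_nhd[of _ "{..<t+1}"]) auto
  ultimately show ?thesis by simp
qed

text \<open>If \<open>f\<close> exceeded \<open>B\<close> at \<open>t\<close>, there would be a last
  earlier time with \<open>f\<close> at most \<open>B\<close>. From then on \<open>f\<close> stays
  above \<open>B\<close>, where its derivative is nonpositive, so the mean value theorem forbids the
  rise.\<close>

lemma barrier:
  fixes f f' :: "real \<Rightarrow> real"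
  assumes der: "\<And>t. t \<ge> 0 \<Longrightarrow> (f has_real_derivative f' t) (at t within {0..})"
    and start: "f 0 \<le> B"
    and nonpos: "\<And>t. t \<ge> 0 \<Longrightarrow> f t > B \<Longrightarrow> f' t \<le> 0"
    and "t \<ge> 0"
  shows "f t \<le> B"
proof (rule ccontr)
  assume "\<not> f t \<le> B"
  then have ft: "f t > B" by simp
  have cont: "continuous_on {0..t} f"
    by (rule continuous_on_subset[of "{0..}"])
      (auto intro!: DERIV_continuous_on der)
  define S where "S = {0..t} \<inter> f -` {..B}"
  have "compact S"
    unfolding S_def
    using continuous_closed_preimage[OF cont] by (simp add: compact_eq_bounded_closed bounded_Int)
  moreover have "0 \<in> S" using start \<open>t \<ge> 0\<close> by (simp add: S_def)
  ultimately obtain s where s: "s \<in> S" "\<And>s'. s' \<in> S \<Longrightarrow> s' \<le> s"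
    using compact_attains_sup[of S] by blast
  have st: "0 \<le> s" "s < t" "f s \<le> B"
    using s(1) ft by (auto simp: S_def order_le_less)
  have above: "f q > B" if "s < q" "q \<le> t" for q
    using s(2)[of q] that st by (auto simp: S_def not_le[symmetric])
  have "\<exists>q\<in>{s<..<t}. f t - f s = f' q * (t - s)"
  proof (rule mvt[OF \<open>s < t\<close>, of f "\<lambda>q. (*) (f' q)"])
    show "continuous_on {s..t} f"
      using continuous_on_subset[OF cont] st by auto
    fix q assume q: "s < q" "q < t"
    have "at q within {0..} = at q"
      using q st by (intro at_within_interior) auto
    then show "(f has_derivative (*) (f' q)) (at q)"
      using der[of q] q st by (simp add: has_field_derivative_def)
  qed auto
  then obtain q where q: "q \<in> {s<..<t}" "f t - f s = f' q * (t - s)" by blast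
  have "f' q \<le> 0" using q st by (intro nonpos above) auto
  then have "f' q * (t - s) \<le> 0"
    using st by (intro mult_nonpos_nonneg) auto
  then show False using q(2) ft st by linarith
qed

text \<open>The integrating factor makes \<open>u t * exp (- integral {0..t} a)\<close> constant.
  The point is sign preservation: \<open>u t\<close> inherits the sign of \<open>u 0\<close>, and
  \<open>a\<close> may itself depend on the solution.\<close>

lemma linear_ode_solution:
  fixes a u :: "real \<Rightarrow> real"
  assumes a: "continuous_on {0..} a"
    and u: "\<And>t. t \<ge> 0 \<Longrightarrow> (u has_real_derivative u t * a t) (at t within {0..})"
    and "t \<ge> 0"
  shows "u t = u 0 * exp (integral {0..t} a)"
proof -
  let ?A = "\<lambda>t. integral {0..t} a"
  have "((\<lambda>t. u t * exp (- ?A t)) has_real_derivative 0) (at s within {0..})" if "s \<in> {0..}" for s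
  proof -
    have "(?A has_real_derivative a s) (at s within {0..})"
      using half_line_integral_has_vector_derivative[OF a, of s] that
      by (simp add: has_real_derivative_iff_has_vector_derivative)
    with u[of s] that show ?thesis
      by (auto intro!: derivative_eq_intros simp: algebra_simps)
  qed
  then obtain c where c: "\<And>s. s \<ge> 0 \<Longrightarrow> u s * exp (- ?A s) = c"
    using has_field_derivative_zero_constant[of "{0..}" "\<lambda>t. u t * exp (- ?A t)"] by auto
  from c[of 0] c[OF \<open>t \<ge> 0\<close>] show ?thesis
    by (simp add: exp_minus field_simps)
qed

text \<open>
  A Barbalat-type argument: whenever \<open>\<bar>z\<bar> \<ge> \<epsilon>\<close>, the Lipschitz bound keeps
  \<open>\<bar>z\<bar> \<ge> \<epsilon> / 2\<close> for a time \<open>\<epsilon> / (2 * C)\<close>, and \<open>V\<close> drops by a fixed amount.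
\<close>
lemma dissipated_tendsto_zero:
  fixes V V' z z' :: "real \<Rightarrow> real"
  assumes V: "\<And>t. t \<ge> 0 \<Longrightarrow> (V has_real_derivative V' t) (at t within {0..})"
    and z: "\<And>t. t \<ge> 0 \<Longrightarrow> (z has_real_derivative z' t) (at t within {0..})"
    and diss: "\<And>t. t \<ge> 0 \<Longrightarrow> V' t \<le> - k * (z t)\<^sup>2"
    and C: "\<And>t. t \<ge> 0 \<Longrightarrow> \<bar>z' t\<bar> \<le> C"
    and "k > 0" "C > 0" and lim: "(V \<longlongrightarrow> L) at_top"
  shows "(z \<longlongrightarrow> 0) at_top"
proof (rule tendstoI)
  fix e :: real assume "e > 0"
  define h where "h = e / (2 * C)"
  define d where "d = k * (e / 2)\<^sup>2 * h"
  have "h > 0" using \<open>e > 0\<close> \<open>C > 0\<close> by (simp add: h_def)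
  then have "d > 0" using \<open>e > 0\<close> \<open>k > 0\<close> by (simp add: d_def)
  \<comment> \<open>Two values of \<open>V\<close> this close to \<open>L\<close> differ by less
    than \<open>d\<close>, which rules out a drop by \<open>d\<close>.\<close>
  have "\<forall>\<^sub>F t in at_top. dist (V t) L < d / 2"
    using \<open>d > 0\<close> by (intro tendstoD[OF lim]) simp
  then obtain T where T: "\<And>t. t \<ge> T \<Longrightarrow> \<bar>V t - L\<bar> < d / 2"
    by (auto simp: eventually_at_top_linorder dist_real_def)
  have "dist (z t) 0 < e" if t: "t \<ge> max 0 T" for t
  proof (rule ccontr)
    assume "\<not> dist (z t) 0 < e"
    then have zt: "\<bar>z t\<bar> \<ge> e" by simp
    have zs: "\<bar>z s\<bar> \<ge> e / 2" if s: "s \<in> {t..t+h}" for s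
    proof -
      obtain q where q: "q \<in> {t..s}" "z s - z t = z' q * (s - t)"
        using half_line_mvt[OF z, of t s] s t by auto
      have "\<bar>z s - z t\<bar> \<le> C * h"
        unfolding q(2) abs_mult using C[of q] q s t by (intro mult_mono) auto
      also have "\<dots> = e / 2" using \<open>C > 0\<close> by (simp add: h_def)
      finally show ?thesis using zt by linarith
    qed
    obtain q where q: "q \<in> {t..t+h}" "V (t + h) - V t = V' q * h"
      using half_line_mvt[OF V, of t "t + h"] t \<open>h > 0\<close> by auto
    have "(e / 2)\<^sup>2 \<le> (z q)\<^sup>2"
      using zs[OF q(1)] \<open>e > 0\<close> by (simp add: abs_le_square_iff[symmetric])
    then have "k * (e / 2)\<^sup>2 \<le> k * (z q)\<^sup>2" using \<open>k > 0\<close> by simp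
    then have "V' q \<le> - (k * (e / 2)\<^sup>2)" using diss[of q] q t by auto
    then have "V' q * h \<le> - d"
      using mult_right_mono[of "V' q" _ h] \<open>h > 0\<close> by (fastforce simp: d_def)
    then show False
      using q(2) T[of t] T[of "t + h"] t \<open>h > 0\<close> by (auto simp: abs_if split: if_splits)
  qed
  then show "\<forall>\<^sub>F t in at_top. dist (z t) 0 < e"
    unfolding eventually_at_top_linorder by blast
qed

lemma antimono_bounded_tendsto_at_top:
  fixes V :: "real \<Rightarrow> real"
  assumes anti: "\<And>s t. 0 \<le> s \<Longrightarrow> s \<le> t \<Longrightarrow> V t \<le> V s"
    and lower: "\<And>t. t \<ge> 0 \<Longrightarrow> V t \<ge> m"
  shows "\<exists>L. (V \<longlongrightarrow> L) at_top"
proof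
  let ?L = "Inf (V ` {0..})"
  have bdd: "bdd_below (V ` {0..})" using lower by (auto intro!: bdd_belowI)
  show "(V \<longlongrightarrow> ?L) at_top"
  proof (rule decreasing_tendsto)
    show "\<forall>\<^sub>F t in at_top. ?L \<le> V t"
      using eventually_ge_at_top[of 0] by eventually_elim (auto intro!: cInf_lower bdd)
    fix b assume "?L < b"
    then obtain s where s: "s \<ge> 0" "V s < b"
      using cInf_less_iff[OF _ bdd] by auto
    show "\<forall>\<^sub>F t in at_top. V t < b"
      using eventually_ge_at_top[of s] by eventually_elim (use s anti in \<open>force\<close>)
  qed
qed

subsection \<open>Global solutions of Lipschitz systems\<close>

text \<open>Integrating \<open>k * exp (c * s)\<close> gains a factor \<open>1 / c\<close>, and the
  weight cancels the exponential. This yields both the boundedness of Picard iterates and the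
  contraction estimate.\<close>

lemma weighted_integral_bound:
  fixes h :: "real \<Rightarrow> 'a::banach"
  assumes "c > 0" "t \<ge> 0" "k \<ge> 0" and cont: "continuous_on {0..} h"
    and bound: "\<And>s. s \<ge> 0 \<Longrightarrow> norm (h s) \<le> k * exp (c * s)"
  shows "norm (exp (- c * t) *\<^sub>R integral {0..t} h) \<le> k / c"
proof -
  have I: "((\<lambda>s. k * exp (c * s)) has_integral (k / c * exp (c * t) - k / c * exp (c * 0))) {0..t}"
    using \<open>c > 0\<close>
    by (intro fundamental_theorem_of_calculus \<open>t \<ge> 0\<close>)
      (auto intro!: derivative_eq_intros simp flip: has_real_derivative_iff_has_vector_derivative)
  have "norm (integral {0..t} h) \<le> integral {0..t} (\<lambda>s. k * exp (c * s))"
    using I bound continuous_on_subset[OF cont]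
    by (intro integral_norm_bound_integral integrable_continuous_real) (auto intro!: continuous_intros)
  also have "\<dots> = k / c * exp (c * t) - k / c"
    using integral_unique[OF I] by simp
  also have "\<dots> \<le> k / c * exp (c * t)"
    using assms by simp
  finally have "exp (- c * t) * norm (integral {0..t} h) \<le> exp (- c * t) * (k / c * exp (c * t))"
    by (intro mult_left_mono) auto
  also have "\<dots> = k / c"
    by (simp add: exp_minus)
  finally show ?thesis by simp
qed

text \<open>
  Solutions are sought in the form \<open>p + exp (c * t) *\<^sub>R g t\<close> with \<open>g\<close> bounded and
  \<open>c = 2 * L\<close>; the exponential weight makes the Picard operator a contraction of factor \<open>1/2\<close> on
  the whole half line at once. Functions are frozen at \<open>t = 0\<close> for negative times.
\<close>
lemma lipschitz_forward_solution_exists: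
  fixes f :: "'a::banach \<Rightarrow> 'a"
  assumes lip: "\<And>x y. norm (f x - f y) \<le> L * norm (x - y)" and "L > 0"
  shows "\<exists>u. forward_solution f u \<and> u 0 = p"
proof -
  define c where "c = 2 * L"
  have "c > 0" using \<open>L > 0\<close> by (simp add: c_def)
  have contf: "continuous_on UNIV f"
  proof (rule lipschitz_on_continuous_on[of L])
    show "L-lipschitz_on UNIV f"
      using lip \<open>L > 0\<close> by (auto simp: lipschitz_on_def dist_norm)
  qed
  define F where "F g s = f (p + exp (c * s) *\<^sub>R apply_bcontfun g s)" for g :: "real \<Rightarrow>\<^sub>C 'a" and s
  have contF: "continuous_on S (F g)" for g S
    unfolding F_def
    by (intro continuous_on_compose2[OF contf] continuous_intros) auto
  have growth: "norm (F g s) \<le> (norm (f p) + L * norm g) * exp (c * s)" if "s \<ge> 0" for g s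
  proof -
    have "norm (F g s) \<le> norm (f p) + norm (F g s - f p)"
      by (metis add.commute diff_add_cancel norm_triangle_ineq)
    also have "norm (F g s - f p) \<le> L * norm (exp (c * s) *\<^sub>R apply_bcontfun g s)"
      unfolding F_def using lip[of "p + exp (c * s) *\<^sub>R apply_bcontfun g s" p] by simp
    also have "\<dots> \<le> L * (exp (c * s) * norm g)"
      using \<open>L > 0\<close> by (simp add: norm_bounded)
    \<comment> \<open>The constant is absorbed into the growth rate that the weight compensates,
      since \<open>exp (c * s)\<close> is at least 1.\<close>
    also have "norm (f p) \<le> norm (f p) * exp (c * s)"
      using that \<open>c > 0\<close> by (simp add: mult_le_cancel_left1)
    finally show ?thesis by (simp add: algebra_simps)
  qed
  \<comment> \<open>\<open>I g\<close> is the Picard integral in the weighted unknown: for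
    \<open>t \<ge> 0\<close>, \<open>g t = I g t\<close> says exactly that
    \<open>p + exp (c * t) *\<^sub>R g t\<close> solves the integral equation.\<close>
  define I where "I g t = exp (- c * t) *\<^sub>R integral {0..t} (F g)" for g t
  have I_deriv: "((\<lambda>t. integral {0..t} (F g)) has_vector_derivative F g t) (at t within {0..})"
    if "t \<ge> 0" for g t
    using half_line_integral_has_vector_derivative[OF contF that] .
  have contI: "continuous_on {0..} (I g)" for g
    unfolding I_def
    by (intro continuous_intros continuous_on_vector_derivative[of "{0..}" _ "F g"] I_deriv) auto
  define T where "T g = Bcontfun (\<lambda>t. I g (max 0 t))" for g
  have T: "apply_bcontfun (T g) t = I g (max 0 t)" for g t
  proof -
    have "(\<lambda>t. I g (max 0 t)) \<in> bcontfun"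
    proof (rule bcontfun_normI)
      show "continuous_on UNIV (\<lambda>t. I g (max 0 t))"
        by (intro continuous_on_compose2[OF contI] continuous_intros) auto
      show "norm (I g (max 0 t)) \<le> (norm (f p) + L * norm g) / c" for t
        unfolding I_def using \<open>c > 0\<close> \<open>L > 0\<close>
        by (intro weighted_integral_bound contF growth) auto
    qed
    then show ?thesis by (simp add: T_def Bcontfun_inverse)
  qed
  have "dist (T g) (T h) \<le> 1/2 * dist g h" for g h
  proof (rule dist_bound)
    fix t :: real
    let ?t = "max 0 t"
    have "I g ?t - I h ?t = exp (- c * ?t) *\<^sub>R integral {0..?t} (\<lambda>s. F g s - F h s)"
      unfolding I_def
      by (subst integral_diff) (auto intro!: integrable_continuous_real contF simp: algebra_simps)
    moreover have "norm (exp (- c * ?t) *\<^sub>R integral {0..?t} (\<lambda>s. F g s - F h s)) \<le> L * dist g h / c"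
    proof (rule weighted_integral_bound)
      fix s :: real
      have "norm (F g s - F h s)
          \<le> L * norm (exp (c * s) *\<^sub>R (apply_bcontfun g s - apply_bcontfun h s))"
        using lip unfolding F_def by (metis add_diff_cancel_left scaleR_right_diff_distrib)
      also have "\<dots> \<le> L * (exp (c * s) * dist g h)"
        using \<open>L > 0\<close> dist_bounded[of g s h] by (simp add: dist_norm)
      finally show "norm (F g s - F h s) \<le> L * dist g h * exp (c * s)"
        by (simp add: algebra_simps)
    qed (use \<open>c > 0\<close> \<open>L > 0\<close> in \<open>auto intro!: continuous_intros contF\<close>)
    ultimately show "dist (apply_bcontfun (T g) t) (apply_bcontfun (T h) t) \<le> 1/2 * dist g h"
      using \<open>L > 0\<close> by (simp add: T dist_norm c_def)
  qed
  then obtain g where g: "T g = g"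
    using banach_fix_type[of "1/2" T] by auto
  define u where "u t = p + exp (c * t) *\<^sub>R apply_bcontfun g t" for t
  have u: "u t = p + integral {0..t} (F g)" if "t \<ge> 0" for t
  proof -
    have "apply_bcontfun g t = I g t" using T[of g t] g that by simp
    then show ?thesis by (simp add: u_def I_def exp_minus)
  qed
  have "forward_solution f u"
    unfolding forward_solution_def
  proof (intro allI impI)
    fix t :: real assume "t \<ge> 0"
    have "((\<lambda>t. p + integral {0..t} (F g)) has_vector_derivative f (u t)) (at t within {0..})"
      (is "(?w has_vector_derivative _) _")
      using I_deriv[OF \<open>t \<ge> 0\<close>, of g]
      by (auto intro!: derivative_eq_intros simp: F_def u_def)
    moreover have "u s = ?w s" if "s \<in> {0..}" for s
      using u that by simp
    ultimately show "(u has_vector_derivative f (u t)) (at t within {0..})"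
      using \<open>t \<ge> 0\<close> by (meson atLeast_iff has_vector_derivative_transform)
  qed
  moreover have "u 0 = p" using u[of 0] by simp
  ultimately show ?thesis by blast
qed

subsection \<open>Solutions of the phytoplankton-zooplankton system\<close>

lemma forward_solution_pair_derivatives:
  assumes "forward_solution f u" "t \<ge> 0"
  shows "((\<lambda>t. fst (u t)) has_real_derivative fst (f (u t))) (at t within {0..})"
    and "((\<lambda>t. snd (u t)) has_real_derivative snd (f (u t))) (at t within {0..})"
  using assms
  by (auto simp: forward_solution_def has_real_derivative_iff_has_vector_derivative
      intro!: bounded_linear.has_vector_derivative[OF bounded_linear_fst]
        bounded_linear.has_vector_derivative[OF bounded_linear_snd])

lemma forward_solution_continuous_on:
  assumes "forward_solution f u"
  shows "continuous_on {0..} u"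
  using assms by (intro continuous_on_vector_derivative) (auto simp: forward_solution_def)

text \<open>Along a given solution each component satisfies a scalar linear equation with continuous
  coefficient, \<open>1 - x - y\<close> and \<open>\<gamma> * x - r\<close> respectively, so it
  keeps its initial sign.\<close>

lemma pz_solution_in_states:
  assumes sol: "forward_solution (pz_field \<gamma> r) u" and "u 0 \<in> pz_states" and "t \<ge> 0"
  shows "u t \<in> pz_states"
proof -
  let ?x = "\<lambda>t. fst (u t)" and ?y = "\<lambda>t. snd (u t)"
  note cont = forward_solution_continuous_on[OF sol]
  have "?x t = ?x 0 * exp (integral {0..t} (\<lambda>t. 1 - ?x t - ?y t))"
    using forward_solution_pair_derivatives(1)[OF sol]
    by (intro linear_ode_solution \<open>t \<ge> 0\<close> continuous_intros cont)
      (simp add: pz_field_def split_beta algebra_simps)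
  moreover have "?y t = ?y 0 * exp (integral {0..t} (\<lambda>t. \<gamma> * ?x t - r))"
    using forward_solution_pair_derivatives(2)[OF sol]
    by (intro linear_ode_solution \<open>t \<ge> 0\<close> continuous_intros cont)
      (simp add: pz_field_def split_beta algebra_simps)
  ultimately show ?thesis
    using \<open>u 0 \<in> pz_states\<close> by (auto simp: pz_states_def mem_Times_iff)
qed

section \<open>The field with clamped densities, and forward completeness\<close>

definition clamp_abs :: "real \<Rightarrow> real \<Rightarrow> real" where
  "clamp_abs M x = max (- M) (min M x)"

lemma clamp_abs_bound: "M \<ge> 0 \<Longrightarrow> \<bar>clamp_abs M x\<bar> \<le> M"
  by (auto simp: clamp_abs_def)

lemma clamp_abs_lipschitz: "\<bar>clamp_abs M x - clamp_abs M y\<bar> \<le> \<bar>x - y\<bar>"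
  by (auto simp: clamp_abs_def max_def min_def)

text \<open>The clamp is the unknown times a continuous factor, so the clamped equations are still
  of the linear form that preserves signs.\<close>

lemma clamp_abs_eq: "M > 0 \<Longrightarrow> clamp_abs M x = x * (M / max M \<bar>x\<bar>)"
  by (auto simp: clamp_abs_def max_def min_def field_simps)

lemma clamp_abs_mult_lipschitz:
  assumes "M \<ge> 0" "K \<ge> 0"
  shows "\<bar>clamp_abs M x * clamp_abs K y - clamp_abs M x' * clamp_abs K y'\<bar>
    \<le> K * \<bar>x - x'\<bar> + M * \<bar>y - y'\<bar>"
proof -
  have "clamp_abs M x * clamp_abs K y - clamp_abs M x' * clamp_abs K y'
      = clamp_abs K y * (clamp_abs M x - clamp_abs M x')
        + clamp_abs M x' * (clamp_abs K y - clamp_abs K y')"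
    by (simp add: algebra_simps)
  also have "\<bar>\<dots>\<bar> \<le> K * \<bar>x - x'\<bar> + M * \<bar>y - y'\<bar>"
    using assms
    by (intro order.trans[OF abs_triangle_ineq] add_mono)
      (auto simp: abs_mult intro!: mult_mono clamp_abs_bound clamp_abs_lipschitz)
  finally show ?thesis .
qed

text \<open>Only the nonlinear terms need clamping; \<open>r * y\<close> is already globally
  Lipschitz.\<close>

definition pz_clamped :: "real \<Rightarrow> real \<Rightarrow> real \<Rightarrow> real \<Rightarrow> real \<times> real \<Rightarrow> real \<times> real" where
  "pz_clamped M K \<gamma> r = (\<lambda>(x, y).
     (clamp_abs M x * (1 - clamp_abs M x - clamp_abs K y),
      \<gamma> * clamp_abs M x * clamp_abs K y - r * y))"

lemma pz_clamped_lipschitz: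
  assumes "M \<ge> 0" "K \<ge> 0" "\<gamma> \<ge> 0" "r \<ge> 0"
  shows "norm (pz_clamped M K \<gamma> r p - pz_clamped M K \<gamma> r q)
    \<le> (1 + 3 * M + K + \<gamma> * (K + M) + r) * norm (p - q)"
proof -
  obtain x y x' y' where pq: "p = (x, y)" "q = (x', y')" by fastforce
  let ?c = "clamp_abs M" and ?k = "clamp_abs K" and ?n = "norm (p - q)"
  have n: "\<bar>x - x'\<bar> \<le> ?n" "\<bar>y - y'\<bar> \<le> ?n"
    using norm_fst_le[of "x - x'" "y - y'"] norm_snd_le[of "y - y'" "x - x'"] by (auto simp: pq)
  have xx: "\<bar>?c x * ?c x - ?c x' * ?c x'\<bar> \<le> 2 * M * ?n"
    using clamp_abs_mult_lipschitz[of M M x x x' x'] assms mult_left_mono[OF n(1), of "2 * M"]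
    by linarith
  have xy: "\<bar>?c x * ?k y - ?c x' * ?k y'\<bar> \<le> (K + M) * ?n"
    using clamp_abs_mult_lipschitz[of M K x y x' y'] assms
      mult_left_mono[OF n(1), of K] mult_left_mono[OF n(2), of M]
    by (simp add: algebra_simps)
  have "\<bar>fst (pz_clamped M K \<gamma> r p - pz_clamped M K \<gamma> r q)\<bar>
      = \<bar>(?c x - ?c x') - (?c x * ?c x - ?c x' * ?c x') - (?c x * ?k y - ?c x' * ?k y')\<bar>"
    by (simp add: pz_clamped_def pq algebra_simps)
  also have "\<dots> \<le> ?n + 2 * M * ?n + (K + M) * ?n"
    using xx xy clamp_abs_lipschitz[of M x x'] n(1) by linarith
  finally have 1: "\<bar>fst (pz_clamped M K \<gamma> r p - pz_clamped M K \<gamma> r q)\<bar>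
    \<le> ?n + 2 * M * ?n + (K + M) * ?n" .
  have "\<bar>snd (pz_clamped M K \<gamma> r p - pz_clamped M K \<gamma> r q)\<bar>
      = \<bar>\<gamma> * (?c x * ?k y - ?c x' * ?k y') - r * (y - y')\<bar>"
    by (simp add: pz_clamped_def pq algebra_simps)
  also have "\<dots> \<le> \<gamma> * \<bar>?c x * ?k y - ?c x' * ?k y'\<bar> + r * \<bar>y - y'\<bar>"
    using assms by (metis abs_mult abs_of_nonneg abs_triangle_ineq4)
  also have "\<dots> \<le> \<gamma> * ((K + M) * ?n) + r * ?n"
    using assms xy n(2) by (intro add_mono mult_left_mono) auto
  finally have 2: "\<bar>snd (pz_clamped M K \<gamma> r p - pz_clamped M K \<gamma> r q)\<bar>
    \<le> \<gamma> * ((K + M) * ?n) + r * ?n" .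
  show ?thesis
    \<comment> \<open>The norm of a pair is at most the sum of the absolute values of its
      components, so the Lipschitz constant is the sum of \<open>1 + 2 * M + (K + M)\<close> and
      \<open>\<gamma> * (K + M) + r\<close>.\<close>
    using norm_Pair_le[of "fst (pz_clamped M K \<gamma> r p - pz_clamped M K \<gamma> r q)"
        "snd (pz_clamped M K \<gamma> r p - pz_clamped M K \<gamma> r q)"] 1 2
    by (simp only: prod.collapse real_norm_def) (simp add: algebra_simps)
qed

text \<open>The clamps are removed in order. Signs come first, then \<open>x \<le> M\<close>, then
  the bound on \<open>\<gamma> * x + y\<close>, whose derivative is computed with the clamp on
  \<open>x\<close> already gone.\<close>

lemma pz_forward_complete:
  assumes "0 < \<gamma>" "\<gamma> \<le> r"
  shows "forward_complete_on (pz_field \<gamma> r) pz_states"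
  unfolding forward_complete_on_def
proof
  fix p assume p: "p \<in> pz_states"
  \<comment> \<open>Above 1 the prey cannot grow, so \<open>M\<close> is a barrier for
    \<open>x\<close>. In \<open>K\<close>, the term \<open>snd p\<close> covers the initial value,
    and the summand 1 makes \<open>\<gamma> * x + y > K\<close> force
    \<open>y \<ge> 1\<close>.\<close>
  define M where "M = max 1 (fst p)"
  define K where "K = \<gamma> * M + snd p + 1"
  have p': "fst p > 0" "snd p \<ge> 0" using p by (auto simp: pz_states_def)
  then have M: "M \<ge> 1" "fst p \<le> M" by (auto simp: M_def)
  have K: "K > 0" "K \<ge> \<gamma> * M + 1"
    using M p' assms by (auto simp: K_def add_nonneg_pos)
  have "1 + 3 * M + K + \<gamma> * (K + M) + r > 0"
    using M K assms by (intro add_pos_nonneg mult_nonneg_nonneg) auto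
  then obtain u where sol: "forward_solution (pz_clamped M K \<gamma> r) u" and "u 0 = p"
    using lipschitz_forward_solution_exists[OF pz_clamped_lipschitz, of M K \<gamma> r p] M K assms
    by auto
  define x where "x t = fst (u t)" for t
  define y where "y t = snd (u t)" for t
  note cont = forward_solution_continuous_on[OF sol]
  have contx: "continuous_on {0..} x" and conty: "continuous_on {0..} y"
    unfolding x_def y_def by (intro continuous_intros cont)+
  let ?c = "clamp_abs M" and ?k = "clamp_abs K"
  have dx: "(x has_real_derivative ?c (x t) * (1 - ?c (x t) - ?k (y t))) (at t within {0..})"
    and dy: "(y has_real_derivative \<gamma> * ?c (x t) * ?k (y t) - r * y t) (at t within {0..})"
    if "t \<ge> 0" for t
    using forward_solution_pair_derivatives[OF sol that]
    by (simp_all add: x_def[abs_def] y_def[abs_def] pz_clamped_def split_beta)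
  have x_pos: "x t > 0" if "t \<ge> 0" for t
  proof -
    have "x t = x 0 * exp (integral {0..t} (\<lambda>t. M / max M \<bar>x t\<bar> * (1 - ?c (x t) - ?k (y t))))"
    proof (rule linear_ode_solution[OF _ _ that])
      show "continuous_on {0..} (\<lambda>t. M / max M \<bar>x t\<bar> * (1 - ?c (x t) - ?k (y t)))"
        unfolding clamp_abs_def using M by (intro continuous_intros contx conty) auto
      fix s :: real assume "s \<ge> 0"
      have "?c (x s) = x s * (M / max M \<bar>x s\<bar>)" using M by (intro clamp_abs_eq) auto
      with dx[OF \<open>s \<ge> 0\<close>] show "(x has_real_derivative
          x s * (M / max M \<bar>x s\<bar> * (1 - ?c (x s) - ?k (y s)))) (at s within {0..})"
        by (simp add: mult.assoc)
    qed
    then show ?thesis using p' \<open>u 0 = p\<close> by (simp add: x_def)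
  qed
  have y_nonneg: "y t \<ge> 0" if "t \<ge> 0" for t
  proof -
    have "y t = y 0 * exp (integral {0..t} (\<lambda>t. \<gamma> * ?c (x t) * (K / max K \<bar>y t\<bar>) - r))"
    proof (rule linear_ode_solution[OF _ _ that])
      show "continuous_on {0..} (\<lambda>t. \<gamma> * ?c (x t) * (K / max K \<bar>y t\<bar>) - r)"
        unfolding clamp_abs_def using K by (intro continuous_intros contx conty) auto
      fix s :: real assume "s \<ge> 0"
      have "?k (y s) = y s * (K / max K \<bar>y s\<bar>)" using K by (intro clamp_abs_eq) auto
      then have "\<gamma> * ?c (x s) * ?k (y s) - r * y s
          = y s * (\<gamma> * ?c (x s) * (K / max K \<bar>y s\<bar>) - r)"
        by (simp add: algebra_simps)
      with dy[OF \<open>s \<ge> 0\<close>] show "(y has_real_derivative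
          y s * (\<gamma> * ?c (x s) * (K / max K \<bar>y s\<bar>) - r)) (at s within {0..})"
        by simp
    qed
    then show ?thesis using p' \<open>u 0 = p\<close> by (simp add: y_def)
  qed
  have k_nonneg: "?k (y t) \<ge> 0" if "t \<ge> 0" for t
    using y_nonneg[OF that] K by (simp add: clamp_abs_def)
  have x_le: "x t \<le> M" if "t \<ge> 0" for t
  proof (rule barrier[OF dx])
    fix s :: real assume s: "s \<ge> 0" "M < x s"
    then have "?c (x s) = M" using M by (simp add: clamp_abs_def)
    then show "?c (x s) * (1 - ?c (x s) - ?k (y s)) \<le> 0"
      using M k_nonneg[OF s(1)] by (simp add: mult_nonneg_nonpos)
  qed (use M \<open>u 0 = p\<close> that in \<open>auto simp: x_def\<close>)
  have cx: "?c (x t) = x t" if "t \<ge> 0" for t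
    using x_pos[OF that] x_le[OF that] M by (simp add: clamp_abs_def)
  text \<open>The predation terms cancel in \<open>\<gamma> * x + y\<close>, clamped or not.\<close>
  have total: "\<gamma> * x t + y t \<le> K" if "t \<ge> 0" for t
  proof (rule barrier[of "\<lambda>t. \<gamma> * x t + y t" "\<lambda>t. \<gamma> * (x t * (1 - x t)) - r * y t"])
    fix s :: real assume s: "s \<ge> 0"
    show "((\<lambda>t. \<gamma> * x t + y t) has_real_derivative \<gamma> * (x s * (1 - x s)) - r * y s)
        (at s within {0..})"
      by (rule derivative_eq_intros dx dy s refl)+ (simp add: cx s algebra_simps)
    assume "K < \<gamma> * x s + y s"
    moreover have "\<gamma> * x s \<le> \<gamma> * M" using x_le[OF s] assms by simp
    ultimately have "y s \<ge> 1" using K(2) by linarith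
    \<comment> \<open>The loss \<open>r * y\<close> is now at least \<open>r\<close>, hence at least
      \<open>\<gamma>\<close>, while the logistic gain is at most \<open>\<gamma>\<close>.\<close>
    then have "r \<le> r * y s" using assms by simp
    moreover have "x s * (1 - x s) \<le> 1"
      using zero_le_power2[of "x s - 1/2"] by (simp add: power2_eq_square algebra_simps)
    then have "\<gamma> * (x s * (1 - x s)) \<le> \<gamma>" using assms by (simp add: mult_left_le)
    ultimately show "\<gamma> * (x s * (1 - x s)) - r * y s \<le> 0" using assms by linarith
  next
    have "\<gamma> * x 0 \<le> \<gamma> * M" using x_le[of 0] assms by simp
    then show "\<gamma> * x 0 + y 0 \<le> K" using \<open>u 0 = p\<close> by (simp add: K_def y_def)
  qed (rule that)
  have ky: "?k (y t) = y t" if "t \<ge> 0" for t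
  proof -
    have "\<gamma> * x t > 0" using x_pos[OF that] assms by simp
    then have "y t \<le> K" using total[OF that] by linarith
    then show ?thesis using y_nonneg[OF that] K by (simp add: clamp_abs_def)
  qed
  have "pz_clamped M K \<gamma> r (u t) = pz_field \<gamma> r (u t)" if "t \<ge> 0" for t
    using cx[OF that] ky[OF that]
    by (simp add: pz_clamped_def pz_field_def split_beta x_def y_def algebra_simps)
  then have "forward_solution (pz_field \<gamma> r) u"
    using sol by (simp add: forward_solution_def)
  moreover have "\<forall>t\<ge>0. u t \<in> pz_states"
    using x_pos y_nonneg by (auto simp: pz_states_def mem_Times_iff x_def y_def)
  ultimately show "\<exists>u. forward_solution (pz_field \<gamma> r) u \<and> u 0 = p \<and> (\<forall>t\<ge>0. u t \<in> pz_states)"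
    using \<open>u 0 = p\<close> by blast
qed

subsection \<open>The Lyapunov function\<close>

text \<open>A Volterra-type function: \<open>x - 1 - ln x\<close> is the usual relative term for the
  coordinate 1 of the equilibrium, and \<open>y\<close> enters linearly because its equilibrium
  value is 0. The weight \<open>\<gamma>\<close> cancels the terms in \<open>x * y\<close> in the
  derivative.\<close>

definition pz_lyapunov :: "real \<Rightarrow> real \<times> real \<Rightarrow> real" where
  "pz_lyapunov \<gamma> = (\<lambda>(x, y). \<gamma> * (x - 1 - ln x) + y)"

text \<open>This is \<open>ln z \<le> z - 1\<close> at \<open>z = sqrt x\<close>, after completing
  the square.\<close>

lemma sqrt_minus_one_power2_le:
  fixes x :: real
  assumes "x > 0"
  shows "(sqrt x - 1)\<^sup>2 \<le> x - 1 - ln x"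
proof -
  have "ln x = 2 * ln (sqrt x)" using assms by (simp add: ln_sqrt)
  also have "\<dots> \<le> 2 * (sqrt x - 1)" using assms ln_le_minus_one[of "sqrt x"] by simp
  finally show ?thesis
    using assms by (simp add: power2_diff)
qed

text \<open>With \<open>s = sqrt (v / \<gamma>)\<close>, the previous estimate gives
  \<open>\<bar>sqrt x - 1\<bar> \<le> s\<close>; the third bound follows by factoring
  \<open>x - 1\<close> as \<open>(sqrt x - 1) * (sqrt x + 1)\<close>.\<close>

lemma pz_lyapunov_controls:
  assumes "\<gamma> > 0" "(x, y) \<in> pz_states"
  defines "v \<equiv> pz_lyapunov \<gamma> (x, y)"
  shows "0 \<le> v" "y \<le> v" "\<bar>x - 1\<bar> \<le> sqrt (v / \<gamma>) * (sqrt (v / \<gamma>) + 2)"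
proof -
  let ?s = "sqrt (v / \<gamma>)"
  have xy: "x > 0" "y \<ge> 0" using assms by (auto simp: pz_states_def)
  have sq: "(sqrt x - 1)\<^sup>2 \<le> x - 1 - ln x" using xy by (intro sqrt_minus_one_power2_le)
  then have ln: "\<gamma> * (x - 1 - ln x) \<ge> 0"
    using \<open>\<gamma> > 0\<close> order.trans[OF zero_le_power2 sq] by simp
  then show "0 \<le> v" "y \<le> v" using xy by (auto simp: v_def pz_lyapunov_def)
  have "x - 1 - ln x \<le> v / \<gamma>"
    using \<open>\<gamma> > 0\<close> xy by (simp add: v_def pz_lyapunov_def field_simps)
  with sq have "(sqrt x - 1)\<^sup>2 \<le> v / \<gamma>" by linarith
  then have s: "\<bar>sqrt x - 1\<bar> \<le> ?s"
    using real_sqrt_le_mono by fastforce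
  have "x - 1 = (sqrt x - 1) * (sqrt x + 1)"
    using xy by (simp add: algebra_simps)
  then have "\<bar>x - 1\<bar> = \<bar>sqrt x - 1\<bar> * \<bar>sqrt x + 1\<bar>"
    by (simp only: abs_mult)
  also have "\<dots> \<le> ?s * (?s + 2)"
    using s xy \<open>0 \<le> v\<close> \<open>\<gamma> > 0\<close> by (intro mult_mono) auto
  finally show "\<bar>x - 1\<bar> \<le> ?s * (?s + 2)" .
qed

lemma pz_lyapunov_derivative:
  assumes sol: "forward_solution (pz_field \<gamma> r) u" and "u 0 \<in> pz_states" and "t \<ge> 0"
  shows "((\<lambda>t. pz_lyapunov \<gamma> (u t)) has_real_derivative
    - \<gamma> * (fst (u t) - 1)\<^sup>2 - (r - \<gamma>) * snd (u t)) (at t within {0..})"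
proof -
  have pos: "fst (u t) > 0"
    using pz_solution_in_states[OF assms] by (auto simp: pz_states_def)
  note d = forward_solution_pair_derivatives[OF sol \<open>t \<ge> 0\<close>]
  have "((\<lambda>t. \<gamma> * (fst (u t) - 1 - ln (fst (u t))) + snd (u t)) has_real_derivative
      - \<gamma> * (fst (u t) - 1)\<^sup>2 - (r - \<gamma>) * snd (u t)) (at t within {0..})"
    by (rule derivative_eq_intros d refl pos)+
      (use pos in \<open>simp add: pz_field_def split_beta power2_eq_square field_simps\<close>)
  then show ?thesis by (simp add: pz_lyapunov_def split_beta)
qed

lemma pz_lyapunov_antimono:
  assumes "0 < \<gamma>" "\<gamma> \<le> r"
    and sol: "forward_solution (pz_field \<gamma> r) u" and start: "u 0 \<in> pz_states"
    and st: "0 \<le> s" "s \<le> t"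
  shows "pz_lyapunov \<gamma> (u t) \<le> pz_lyapunov \<gamma> (u s)"
proof -
  obtain q where q: "q \<in> {s..t}" "pz_lyapunov \<gamma> (u t) - pz_lyapunov \<gamma> (u s)
      = (- \<gamma> * (fst (u q) - 1)\<^sup>2 - (r - \<gamma>) * snd (u q)) * (t - s)"
    using half_line_mvt[OF pz_lyapunov_derivative[OF sol start] st] by auto
  have "snd (u q) \<ge> 0"
    using pz_solution_in_states[OF sol start, of q] q st by (auto simp: pz_states_def)
  then have "(r - \<gamma>) * snd (u q) \<ge> 0" "\<gamma> * (fst (u q) - 1)\<^sup>2 \<ge> 0" using assms by auto
  then have "(- \<gamma> * (fst (u q) - 1)\<^sup>2 - (r - \<gamma>) * snd (u q)) * (t - s) \<le> 0"
    using st by (intro mult_nonpos_nonneg) auto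
  then show ?thesis using q(2) by linarith
qed

section \<open>Stability and attractivity of the equilibrium\<close>

lemma pz_lyapunov_stable:
  assumes "0 < \<gamma>" "\<gamma> \<le> r"
  shows "lyapunov_stable_on (pz_field \<gamma> r) pz_states (1, 0)"
  unfolding lyapunov_stable_on_def
proof (intro allI impI)
  fix e :: real assume "e > 0"
  \<comment> \<open>\<open>\<phi>\<close> adds the bounds on \<open>\<bar>x - 1\<bar>\<close> and
    \<open>y\<close>, so it bounds the distance to the equilibrium by the value of the Lyapunov
    function. Being continuous with \<open>\<phi> 0 = 0\<close>, it is small for small
    values.\<close>
  define \<phi> where "\<phi> v = sqrt (v / \<gamma>) * (sqrt (v / \<gamma>) + 2) + v" for v
  have "continuous_on UNIV \<phi>"
    unfolding \<phi>_def using assms by (intro continuous_intros) auto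
  moreover have "\<phi> 0 = 0" by (simp add: \<phi>_def)
  ultimately obtain d where d: "d > 0" "\<And>v. \<bar>v\<bar> < d \<Longrightarrow> \<bar>\<phi> v\<bar> < e"
    using \<open>e > 0\<close> unfolding continuous_on_iff dist_real_def
    by (metis UNIV_I diff_zero)
  have "isCont (\<lambda>p. \<gamma> * (fst p - 1 - ln (fst p)) + snd p) (1::real, 0::real)"
    by (intro continuous_intros) auto
  then have "isCont (pz_lyapunov \<gamma>) (1, 0)"
    by (simp add: pz_lyapunov_def case_prod_unfold)
  then obtain \<delta> where \<delta>: "\<delta> > 0"
    "\<And>p. dist p (1, 0) < \<delta> \<Longrightarrow> \<bar>pz_lyapunov \<gamma> p\<bar> < d"
    using \<open>d > 0\<close> by (force simp: continuous_at_eps_delta dist_real_def pz_lyapunov_def)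
  have "dist (u t) (1, 0) < e"
    if u: "forward_solution (pz_field \<gamma> r) u" "u 0 \<in> pz_states" "dist (u 0) (1, 0) < \<delta>"
      and t: "t \<ge> 0" for u t
  proof -
    obtain x y where xy: "u t = (x, y)" by fastforce
    then have st: "(x, y) \<in> pz_states" using pz_solution_in_states[OF u(1,2) t] by simp
    let ?v = "pz_lyapunov \<gamma> (x, y)"
    note v = pz_lyapunov_controls[OF \<open>0 < \<gamma>\<close> st]
    have "?v \<le> pz_lyapunov \<gamma> (u 0)"
      using pz_lyapunov_antimono[OF assms u(1,2), of 0 t] t xy by simp
    then have "\<bar>?v\<bar> < d" using v(1) \<delta>(2)[OF u(3)] by linarith
    then have "\<bar>\<phi> ?v\<bar> < e" by (rule d(2))
    moreover have "dist (u t) (1, 0) \<le> \<bar>x - 1\<bar> + \<bar>y\<bar>"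
      using norm_Pair_le[of "x - 1" y] by (simp add: xy dist_norm)
    moreover have "y \<ge> 0" using st by (simp add: pz_states_def)
    ultimately show ?thesis using v unfolding \<phi>_def by linarith
  qed
  then show "\<exists>\<delta>>0. \<forall>u. forward_solution (pz_field \<gamma> r) u \<longrightarrow> u 0 \<in> pz_states \<longrightarrow>
      dist (u 0) (1, 0) < \<delta> \<longrightarrow> (\<forall>t\<ge>0. dist (u t) (1, 0) < e)"
    using \<open>\<delta> > 0\<close> by blast
qed

lemma pz_globally_attractive:
  assumes "0 < \<gamma>" "\<gamma> \<le> r"
  shows "globally_attractive_on (pz_field \<gamma> r) pz_states (1, 0)"
  unfolding globally_attractive_on_def
proof (intro allI impI)
  fix u assume sol: "forward_solution (pz_field \<gamma> r) u" and start: "u 0 \<in> pz_states"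
  define x where "x t = fst (u t)" for t
  define y where "y t = snd (u t)" for t
  have u: "u t = (x t, y t)" for t by (simp add: x_def y_def)
  define V where "V t = pz_lyapunov \<gamma> (u t)" for t
  have st: "(x t, y t) \<in> pz_states" if "t \<ge> 0" for t
    using pz_solution_in_states[OF sol start that] by (simp add: u)
  have pos: "x t > 0" "y t \<ge> 0" if "t \<ge> 0" for t
    using st[OF that] by (auto simp: pz_states_def)
  note controls = pz_lyapunov_controls[OF \<open>0 < \<gamma>\<close> st, folded u V_def]
  have anti: "V t \<le> V s" if "0 \<le> s" "s \<le> t" for s t
    using pz_lyapunov_antimono[OF assms sol start that] by (simp add: V_def)
  then obtain L where L: "(V \<longlongrightarrow> L) at_top"
    using antimono_bounded_tendsto_at_top[of V 0] controls(1) by blast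
  have dV: "(V has_real_derivative - \<gamma> * (x t - 1)\<^sup>2 - (r - \<gamma>) * y t) (at t within {0..})"
    if "t \<ge> 0" for t
    using pz_lyapunov_derivative[OF sol start that] by (simp add: V_def[abs_def] x_def y_def)
  have dx: "(x has_real_derivative x t * (1 - x t) - x t * y t) (at t within {0..})"
    if "t \<ge> 0" for t
    using forward_solution_pair_derivatives(1)[OF sol that]
    by (simp add: x_def[abs_def] y_def pz_field_def split_beta)
  \<comment> \<open>The bound on \<open>\<bar>x - 1\<bar>\<close> is increasing in \<open>V\<close>,
    so its value at time 0 serves for all later times.\<close>
  define B where "B = sqrt (V 0 / \<gamma>) * (sqrt (V 0 / \<gamma>) + 2)"
  have x_bound: "\<bar>x t - 1\<bar> \<le> B" and y_bound: "\<bar>y t\<bar> \<le> V 0" if "t \<ge> 0" for t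
  proof -
    have "0 \<le> V t" "V t \<le> V 0" using controls(1)[OF that] anti[of 0 t] that by auto
    then have "sqrt (V t / \<gamma>) * (sqrt (V t / \<gamma>) + 2) \<le> B"
      unfolding B_def using assms
      by (intro mult_mono add_right_mono real_sqrt_le_mono divide_right_mono) auto
    then show "\<bar>x t - 1\<bar> \<le> B" using controls(3)[OF that] by linarith
    show "\<bar>y t\<bar> \<le> V 0" using controls(2)[OF that] pos(2)[OF that] \<open>V t \<le> V 0\<close> by linarith
  qed
  \<comment> \<open>The nonnegative term \<open>(r - \<gamma>) * y\<close> is discarded, so the case
    \<open>\<gamma> = r\<close> is included. The speed bound for \<open>x\<close> carries an extra 1
    to be positive even when \<open>B = 0\<close>.\<close>
  have "((\<lambda>t. x t - 1) \<longlongrightarrow> 0) at_top"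
  proof (rule dissipated_tendsto_zero[OF dV _ _ _ \<open>0 < \<gamma>\<close> _ L])
    fix t :: real assume t: "t \<ge> 0"
    show "((\<lambda>t. x t - 1) has_real_derivative x t * (1 - x t) - x t * y t) (at t within {0..})"
      by (rule derivative_eq_intros dx t refl)+ simp
    show "- \<gamma> * (x t - 1)\<^sup>2 - (r - \<gamma>) * y t \<le> - \<gamma> * (x t - 1)\<^sup>2"
      using assms pos(2)[OF t] by simp
    have B: "B \<ge> 0" "V 0 \<ge> 0" using x_bound[OF t] y_bound[OF t] by linarith+
    have "\<bar>x t * (1 - x t - y t)\<bar> \<le> (B + 1) * (B + V 0)"
      unfolding abs_mult using x_bound[OF t] y_bound[OF t] B by (intro mult_mono) auto
    then show "\<bar>x t * (1 - x t) - x t * y t\<bar> \<le> (B + 1) * (B + V 0) + 1"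
      by (simp add: algebra_simps)
  next
    have "B \<ge> 0" "V 0 \<ge> 0" using x_bound[of 0] y_bound[of 0] by linarith+
    then show "(B + 1) * (B + V 0) + 1 > 0" by (intro add_nonneg_pos) auto
  qed
  then have x_lim: "(x \<longlongrightarrow> 1) at_top"
    using tendsto_add[of "\<lambda>t. x t - 1" 0 at_top "\<lambda>_. 1" 1] by simp
  \<comment> \<open>Since \<open>x\<close> and \<open>V\<close> both converge, so does their
    remaining ingredient \<open>y\<close>.\<close>
  have "((\<lambda>t. V t - \<gamma> * (x t - 1 - ln (x t))) \<longlongrightarrow> L - \<gamma> * (1 - 1 - ln 1)) at_top"
    by (intro tendsto_intros L x_lim) auto
  moreover have "V t - \<gamma> * (x t - 1 - ln (x t)) = y t" for t
    by (simp add: V_def u pz_lyapunov_def)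
  ultimately have y_lim: "(y \<longlongrightarrow> L) at_top" by simp
  have "L \<ge> 0"
    using eventually_mono[OF eventually_ge_at_top[of 0] pos(2)]
    by (intro tendsto_lowerbound[OF y_lim]) auto
  text \<open>If \<open>L > 0\<close>, then \<open>x'\<close> tends to \<open>- L\<close> and \<open>x\<close> would become negative.\<close>
  have "\<not> L > 0"
  proof
    assume "L > 0"
    have "((\<lambda>t. x t * (1 - x t) - x t * y t) \<longlongrightarrow> 1 * (1 - 1) - 1 * L) at_top"
      by (intro tendsto_intros x_lim y_lim)
    then have "\<forall>\<^sub>F t in at_top. x t * (1 - x t) - x t * y t < - L / 2"
      using \<open>L > 0\<close> by (intro order_tendstoD) auto
    then obtain T where T: "\<And>t. t \<ge> T \<Longrightarrow> x t * (1 - x t) - x t * y t < - L / 2"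
      by (auto simp: eventually_at_top_linorder)
    define s where "s = max 0 T"
    \<comment> \<open>Falling at a rate of at least \<open>L / 2\<close>, \<open>x\<close> loses all
      of \<open>x s\<close> within this time.\<close>
    define h where "h = 2 * x s / L"
    have s: "s \<ge> 0" "s \<ge> T" by (auto simp: s_def)
    have h: "h > 0" using pos(1)[OF s(1)] \<open>L > 0\<close> by (simp add: h_def)
    obtain q where q: "q \<in> {s..s+h}" "x (s + h) - x s = (x q * (1 - x q) - x q * y q) * h"
      using half_line_mvt[OF dx, of s "s + h"] s h by auto
    have "(x q * (1 - x q) - x q * y q) * h \<le> (- L / 2) * h"
      using T[of q] q s h by (intro mult_right_mono) auto
    also have "\<dots> = - x s" using \<open>L > 0\<close> by (simp add: h_def)
    finally show False using q(2) pos(1)[of "s + h"] s h by linarith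
  qed
  with \<open>L \<ge> 0\<close> have "L = 0" by simp
  with x_lim y_lim show "(u \<longlongrightarrow> (1, 0)) at_top"
    unfolding u[abs_def] by (intro tendsto_Pair) auto
qed

theorem theorem1:
  fixes \<gamma> r :: real
  assumes "0 < \<gamma>" and "\<gamma> \<le> r"
  shows "globally_asymptotically_stable_on (pz_field \<gamma> r) pz_states (1, 0)"
  unfolding globally_asymptotically_stable_on_def
  using pz_forward_complete[OF assms] pz_lyapunov_stable[OF assms] pz_globally_attractive[OF assms]
  by (simp add: pz_states_def equilibrium_def pz_field_def zero_prod_def)

end
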